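(* Consider the problem $\min_{x\in\mathbb{R}^n}F(x)$ with $F=(F_1,\dots,F_m)$, $F_i=f_i+g_i$, where each $f_i$ is continuously differentiable and $L_i$-smooth and each $g_i$ is proper, convex and lower semicontinuous. Assume that $f_i$ is strongly convex with modulus $\mu_i>0$ for every $i\in[m]$. Let $\{x^k\}$ be the (infinite) sequence generated by the adaptive Barzilai-Borwein proximal gradient method (ABBPGMO, described in the context) with parameter $\tau>1$, where $\alpha_{\min}$ is small enough that $\alpha_{\min}\le\min_{i\in[m]}L_i$. Then: (i) $\{x^k\}$ converges to some Pareto solution $x^*$. (ii) For all $k\ge0$, $$\|x^{k+1}-x^*\|\le\sqrt{1-\min_{i\in[m]}\left\{\frac{\mu_i}{\tau L_i}\right\}}\;\|x^k-x^*\|.$$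
   Context: Notation: $[m]=\{1,\dots,m\}$; for $u,v\in\mathbb{R}^m$, $u\preceq v$ means $u_i\le v_i$ for all $i$. $F:\mathbb{R}^n\to\mathbb{R}^m$. A point $x^*$ is a Pareto solution if there is no $x$ with $F(x)\preceq F(x^* )$ and $F(x)\ne F(x^* )$. It is Pareto critical if $\max_{i\in[m]}F_i'(x^*;d)\ge0$ for all $d\in\mathbb{R}^n$, where $F_i'(x;d)$ is the directional derivative. A differentiable $h$ is $L$-smooth if $\|\nabla h(y)-\nabla h(x)\|\le L\|y-x\|$ for all $x,y$, and $\mu$-strongly convex if $\langle\nabla h(y)-\nabla h(x),y-x\rangle\ge\mu\|y-x\|^2$ for all $x,y$. ABBPGMO. Fix $\tau>1$ and constants $0<\alpha_{\min}<\alpha_{\max}$ ($\alpha_{\max}$ sufficiently large). Given $x^0$, choose $x^{-1}\ne x^0$ in a small neighborhood of $x^0$. For $\alpha\in\mathbb{R}^m$ with positive entries, let $P_\alpha(x^k)$ be the unique minimizer over $x\in\mathbb{R}^n$ of $\max_{i\in[m]}\left\{\frac{\langle\nabla f_i(x^k),x-x^k\rangle+g_i(x)-g_i(x^k)}{\alpha_i}+\frac12\|x-x^k\|^2\right\}$. For $k=0,1,2,\dots$: 1. With $s^{k-1}=x^k-x^{k-1}$ and $y_i^{k-1}=\nabla f_i(x^k)-\nabla f_i(x^{k-1})$, initialize for each $i\in[m]$: $\alpha_i^k=\max\{\alpha_{\min},\min\{\langle s^{k-1},y_i^{k-1}\rangle/\langle s^{k-1},s^{k-1}\rangle,\alpha_{\max}\}\}$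 if $\langle s^{k-1},y_i^{k-1}\rangle>0$; $\alpha_i^k=\max\{\alpha_{\min},\min\{\|y_i^{k-1}\|/\|s^{k-1}\|,\alpha_{\max}\}\}$ if $\langle s^{k-1},y_i^{k-1}\rangle<0$; $\alpha_i^k=\alpha_{\min}$ if $\langle s^{k-1},y_i^{k-1}\rangle=0$. 2. Set $x^{k+1}=P_{\alpha^k}(x^k)$; stop if $x^{k+1}=x^k$. 3. Repeat: for every $i$ with $f_i(x^{k+1})-f_i(x^k)>\langle\nabla f_i(x^k),x^{k+1}-x^k\rangle+\frac{\alpha_i^k}{2}\|x^{k+1}-x^k\|^2$ replace $\alpha_i^k$ by $\tau\alpha_i^k$; then recompute $x^{k+1}=P_{\alpha^k}(x^k)$; until $f_i(x^{k+1})-f_i(x^k)\le\langle\nabla f_i(x^k),x^{k+1}-x^k\rangle+\frac{\alpha_i^k}{2}\|x^{k+1}-x^k\|^2$ for all $i\in[m]$. Standing assumption: the algorithm does not stop, i.e. it produces an infinite sequence of points that are not Pareto critical. *)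

theory Defs
  imports "HOL-Analysis.Analysis"
begin

section \<open>Smooth and strongly convex functions\<close>

definition grad :: "('a::real_inner \<Rightarrow> real) \<Rightarrow> 'a \<Rightarrow> 'a" where
  "grad h x = (THE D. GDERIV h x :> D)"

lemma GDERIV_grad:
  fixes h :: "'a::euclidean_space \<Rightarrow> real"
  assumes "h differentiable at x"
  shows "GDERIV h x :> grad h x"
proof -
  obtain D where D: "(h has_derivative D) (at x)"
    using assms unfolding differentiable_def by blast
  define v where "v = (\<Sum>b\<in>Basis. D b *\<^sub>R b)"
  have "linear D" using D by (rule has_derivative_linear)
  have "D d = d \<bullet> v" for d
  proof -
    have "D d = D (\<Sum>b\<in>Basis. (d \<bullet> b) *\<^sub>R b)" by (simp add: euclidean_representation)
    also have "\<dots> = (\<Sum>b\<in>Basis. (d \<bullet> b) * D b)"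
      using \<open>linear D\<close> by (simp add: linear_sum linear_cmul)
    also have "\<dots> = d \<bullet> v" by (simp add: v_def inner_sum_right mult.commute)
    finally show ?thesis .
  qed
  hence "D = (\<lambda>d. d \<bullet> v)" by blast
  hence v: "GDERIV h x :> v" using D by (simp add: gderiv_def)
  moreover have "w = v" if "GDERIV h x :> w" for w
  proof -
    have "(\<lambda>d. d \<bullet> w) = (\<lambda>d. d \<bullet> v)"
      using that v unfolding gderiv_def by (rule has_derivative_unique)
    hence "d \<bullet> w = d \<bullet> v" for d by meson
    thus ?thesis by (metis vector_eq_ldot)
  qed
  ultimately show ?thesis unfolding grad_def by (rule theI)
qed

definition continuously_differentiable :: "('a::real_inner \<Rightarrow> real) \<Rightarrow> bool" where
  "continuously_differentiable h \<longleftrightarrow>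
     (\<forall>x. h differentiable at x) \<and> continuous_on UNIV (grad h)"

definition L_smooth :: "real \<Rightarrow> ('a::real_inner \<Rightarrow> real) \<Rightarrow> bool" where
  "L_smooth L h \<longleftrightarrow> (\<forall>x. h differentiable at x) \<and>
     (\<forall>x y. norm (grad h y - grad h x) \<le> L * norm (y - x))"

definition strongly_convex :: "real \<Rightarrow> ('a::real_inner \<Rightarrow> real) \<Rightarrow> bool" where
  "strongly_convex \<mu> h \<longleftrightarrow> (\<forall>x. h differentiable at x) \<and>
     (\<forall>x y. (grad h y - grad h x) \<bullet> (y - x) \<ge> \<mu> * (norm (y - x))\<^sup>2)"

section \<open>Extended-real-valued functions\<close>

definition proper_fun :: "('a \<Rightarrow> ereal) \<Rightarrow> bool" where
  "proper_fun g \<longleftrightarrow> (\<forall>x. g x \<noteq> -\<infinity>) \<and> (\<exists>x. g x \<noteq> \<infinity>)"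

text \<open>Used for functions that never take the value \<open>-\<infinity>\<close>, so the right-hand side below
  never contains \<open>\<infinity> - \<infinity>\<close>; recall that \<open>0 * \<infinity> = 0\<close> in \<^typ>\<open>ereal\<close>.\<close>

definition convex_fun :: "('a::real_vector \<Rightarrow> ereal) \<Rightarrow> bool" where
  "convex_fun g \<longleftrightarrow> (\<forall>x y u v. 0 \<le> u \<and> 0 \<le> v \<and> u + v = 1 \<longrightarrow>
     g (u *\<^sub>R x + v *\<^sub>R y) \<le> ereal u * g x + ereal v * g y)"

definition lsc_fun :: "('a::topological_space \<Rightarrow> ereal) \<Rightarrow> bool" where
  "lsc_fun g \<longleftrightarrow> (\<forall>x. g x \<le> Liminf (at x) g)"

section \<open>Multiobjective composite problems\<close>

text \<open>The \<open>m\<close> objectives are indexed by a finite type \<open>'m\<close>. The order on \<open>'m \<Rightarrow> ereal\<close> is the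
  componentwise one. Since \<open>g\<close> may take the value \<open>\<infinity>\<close>, Pareto solutions and Pareto critical
  points are required to lie in the effective domain \<open>domF F\<close>, where \<open>F\<close> is real-valued; for
  real-valued \<open>g\<close> this requirement is void.\<close>

definition objective ::
    "('m \<Rightarrow> 'a \<Rightarrow> real) \<Rightarrow> ('m \<Rightarrow> 'a \<Rightarrow> ereal) \<Rightarrow> 'a \<Rightarrow> 'm \<Rightarrow> ereal" where
  "objective f g x = (\<lambda>i. ereal (f i x) + g i x)"

definition domF :: "('a \<Rightarrow> 'm \<Rightarrow> ereal) \<Rightarrow> 'a set" where
  "domF F = {x. \<forall>i. \<bar>F x i\<bar> \<noteq> \<infinity>}"

definition pareto_solution :: "('a \<Rightarrow> 'm \<Rightarrow> ereal) \<Rightarrow> 'a \<Rightarrow> bool" where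
  "pareto_solution F x \<longleftrightarrow> x \<in> domF F \<and> \<not> (\<exists>y. F y \<le> F x \<and> F y \<noteq> F x)"

definition dir_deriv :: "('a::real_vector \<Rightarrow> ereal) \<Rightarrow> 'a \<Rightarrow> 'a \<Rightarrow> ereal" where
  "dir_deriv \<phi> x d = Lim (at_right 0) (\<lambda>t::real. (\<phi> (x + t *\<^sub>R d) - \<phi> x) / ereal t)"

definition pareto_critical :: "('a::real_vector \<Rightarrow> 'm::finite \<Rightarrow> ereal) \<Rightarrow> 'a \<Rightarrow> bool" where
  "pareto_critical F x \<longleftrightarrow> x \<in> domF F \<and> (\<forall>d. (MAX i. dir_deriv (\<lambda>z. F z i) x d) \<ge> 0)"

section \<open>The adaptive Barzilai-Borwein proximal gradient method\<close>

definition prox_model ::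
    "('m::finite \<Rightarrow> 'a::real_inner \<Rightarrow> real) \<Rightarrow> ('m \<Rightarrow> 'a \<Rightarrow> ereal) \<Rightarrow> ('m \<Rightarrow> real) \<Rightarrow> 'a \<Rightarrow> 'a \<Rightarrow> ereal"
where
  "prox_model f g \<alpha> x z =
     (MAX i. (ereal (grad (f i) x \<bullet> (z - x)) + g i z - g i x) / ereal (\<alpha> i)
             + ereal (1 / 2 * (norm (z - x))\<^sup>2))"

text \<open>\<open>is_prox f g \<alpha> x z\<close> expresses \<open>z = P\<^sub>\<alpha>(x)\<close>.\<close>

definition is_prox ::
    "('m::finite \<Rightarrow> 'a::real_inner \<Rightarrow> real) \<Rightarrow> ('m \<Rightarrow> 'a \<Rightarrow> ereal) \<Rightarrow> ('m \<Rightarrow> real) \<Rightarrow> 'a \<Rightarrow> 'a \<Rightarrow> bool"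
where
  "is_prox f g \<alpha> x z \<longleftrightarrow>
     is_arg_min (prox_model f g \<alpha> x) (\<lambda>_. True) z \<and>
     (\<forall>w. is_arg_min (prox_model f g \<alpha> x) (\<lambda>_. True) w \<longrightarrow> w = z)"

definition bb_init ::
    "('m \<Rightarrow> 'a::real_inner \<Rightarrow> real) \<Rightarrow> real \<Rightarrow> real \<Rightarrow> 'a \<Rightarrow> 'a \<Rightarrow> 'm \<Rightarrow> real"
where
  "bb_init f \<alpha>\<^sub>m\<^sub>i\<^sub>n \<alpha>\<^sub>m\<^sub>a\<^sub>x x\<^sub>p\<^sub>r\<^sub>e\<^sub>v x i =
     (let s = x - x\<^sub>p\<^sub>r\<^sub>e\<^sub>v; y = grad (f i) x - grad (f i) x\<^sub>p\<^sub>r\<^sub>e\<^sub>v in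
        if s \<bullet> y > 0 then max \<alpha>\<^sub>m\<^sub>i\<^sub>n (min ((s \<bullet> y) / (s \<bullet> s)) \<alpha>\<^sub>m\<^sub>a\<^sub>x)
        else if s \<bullet> y < 0 then max \<alpha>\<^sub>m\<^sub>i\<^sub>n (min (norm y / norm s) \<alpha>\<^sub>m\<^sub>a\<^sub>x)
        else \<alpha>\<^sub>m\<^sub>i\<^sub>n)"

definition descent_ok ::
    "('m \<Rightarrow> 'a::real_inner \<Rightarrow> real) \<Rightarrow> ('m \<Rightarrow> real) \<Rightarrow> 'a \<Rightarrow> 'a \<Rightarrow> 'm \<Rightarrow> bool"
where
  "descent_ok f \<alpha> x z i \<longleftrightarrow>
     f i z - f i x \<le> grad (f i) x \<bullet> (z - x) + \<alpha> i / 2 * (norm (z - x))\<^sup>2"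

text \<open>\<open>backtrack f g \<tau> x \<alpha> z\<close>: the repeat loop at the point \<open>x\<close>, entered with the parameters \<open>\<alpha>\<close>
  and the trial point \<open>P\<^sub>\<alpha>(x)\<close>, terminates with the trial point \<open>z\<close>. (A pass through the loop in
  which no test is violated changes neither \<open>\<alpha>\<close> nor the trial point and ends the loop.)\<close>

inductive backtrack ::
    "('m::finite \<Rightarrow> 'a::real_inner \<Rightarrow> real) \<Rightarrow> ('m \<Rightarrow> 'a \<Rightarrow> ereal) \<Rightarrow> real \<Rightarrow> 'a \<Rightarrow>
     ('m \<Rightarrow> real) \<Rightarrow> 'a \<Rightarrow> bool"
  for f g \<tau> x
where
  accept: "is_prox f g \<alpha> x z \<Longrightarrow> \<forall>i. descent_ok f \<alpha> x z i \<Longrightarrow> backtrack f g \<tau> x \<alpha> z"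
| enlarge: "is_prox f g \<alpha> x w \<Longrightarrow> \<exists>i. \<not> descent_ok f \<alpha> x w i \<Longrightarrow>
    backtrack f g \<tau> x (\<lambda>i. if descent_ok f \<alpha> x w i then \<alpha> i else \<tau> * \<alpha> i) z \<Longrightarrow>
    backtrack f g \<tau> x \<alpha> z"

text \<open>An infinite run of the method: \<open>x k\<close> is the iterate \<open>x\<^sup>k\<close> and \<open>xm1\<close> is \<open>x\<^sup>-\<^sup>1\<close>. The condition
  \<open>z \<noteq> x k\<close> on the first trial point says that the stopping test is never met.\<close>

definition abbpgmo ::
    "('m::finite \<Rightarrow> 'a::real_inner \<Rightarrow> real) \<Rightarrow> ('m \<Rightarrow> 'a \<Rightarrow> ereal) \<Rightarrow> real \<Rightarrow> real \<Rightarrow> real \<Rightarrow>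
     'a \<Rightarrow> (nat \<Rightarrow> 'a) \<Rightarrow> bool"
where
  "abbpgmo f g \<tau> \<alpha>\<^sub>m\<^sub>i\<^sub>n \<alpha>\<^sub>m\<^sub>a\<^sub>x xm1 x \<longleftrightarrow>
     xm1 \<noteq> x 0 \<and>
     (\<forall>k. let \<alpha> = bb_init f \<alpha>\<^sub>m\<^sub>i\<^sub>n \<alpha>\<^sub>m\<^sub>a\<^sub>x (case k of 0 \<Rightarrow> xm1 | Suc j \<Rightarrow> x j) (x k) in
        (\<exists>z. is_prox f g \<alpha> (x k) z \<and> z \<noteq> x k) \<and>
        backtrack f g \<tau> (x k) \<alpha> (x (Suc k)))"

end

theory Submission
  imports Defs
begin

text \<open>If \<open>z\<close> minimizes the model at \<open>x\<close> and \<open>y\<close> is a point of the domain, then moving from \<open>z\<close> towards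
  \<open>y\<close> shows that a single index \<open>i\<close>, depending on \<open>y\<close>, satisfies the first-order optimality
  inequality \<open>(h\<^sub>i(z) - h\<^sub>i(y)) / \<alpha>\<^sub>i \<le> \<langle>z - x, y - z\<rangle>\<close>, where \<open>h\<^sub>i\<close> is the linearized objective; no
  Lagrange multipliers are needed. With the acceptance test and strong convexity this gives
  \<open>\<parallel>z - y\<parallel>\<^sup>2 \<le> (1 - \<mu>\<^sub>i / \<alpha>\<^sub>i) \<parallel>x - y\<parallel>\<^sup>2\<close> for every \<open>y\<close> with \<open>F(y) \<preceq> F(z)\<close>, and backtracking keeps
  \<open>\<alpha>\<^sub>i \<le> \<tau> L\<^sub>i\<close>. The objectives decrease along the run, so the sets \<open>{y. F(y) \<preceq> F(x\<^sup>k)}\<close> are nested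
  and compact. Every point in their intersection attracts the iterates at the linear rate, so this
  point is unique, and a point dominating it would lie in the intersection as well.\<close>

section \<open>Quadratic bounds\<close>

lemma DERIV_along_line:
  fixes h :: "'a::euclidean_space \<Rightarrow> real"
  assumes "\<And>x. h differentiable at x"
  shows "((\<lambda>t. h (x + t *\<^sub>R d)) has_real_derivative (grad h (x + t *\<^sub>R d) \<bullet> d)) (at t)"
proof -
  have "(h has_derivative (\<lambda>e. e \<bullet> grad h (x + t *\<^sub>R d))) (at (x + t *\<^sub>R d))"
    using GDERIV_grad[OF assms] by (simp add: gderiv_def)
  moreover have "((\<lambda>t. x + t *\<^sub>R d) has_derivative (\<lambda>s. s *\<^sub>R d)) (at t)"
    by (auto intro!: derivative_eq_intros)
  ultimately have "((\<lambda>t. h (x + t *\<^sub>R d)) has_derivative (\<lambda>s. (s *\<^sub>R d) \<bullet> grad h (x + t *\<^sub>R d))) (at t)"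
    using has_derivative_compose by fastforce
  then show ?thesis
    by (rule has_derivative_imp_has_field_derivative) (simp add: inner_commute mult.commute)
qed

text \<open>Subtracting the tangent and a parabola leaves a function that is nondecreasing on
  [0, 1]. The sign of \<open>c\<close> is free: strong convexity applies this to \<open>h\<close>,
  smoothness to \<open>- h\<close> with a coefficient built from \<open>- L\<close>.\<close>

lemma quadratic_minorant:
  fixes \<phi> :: "real \<Rightarrow> real"
  assumes "\<And>t. (\<phi> has_real_derivative \<phi>' t) (at t)"
    and "\<And>t. 0 \<le> t \<Longrightarrow> \<phi>' t \<ge> \<phi>' 0 + c * t"
  shows "\<phi> 1 \<ge> \<phi> 0 + \<phi>' 0 + c / 2"
proof -
  define \<psi> where "\<psi> t = \<phi> t - t * \<phi>' 0 - c / 2 * t\<^sup>2" for t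
  have "(\<psi> has_real_derivative (\<phi>' t - \<phi>' 0 - c * t)) (at t)" for t
    unfolding \<psi>_def by (auto intro!: derivative_eq_intros assms(1))
  moreover have "\<phi>' t - \<phi>' 0 - c * t \<ge> 0" if "0 \<le> t" for t
    using assms(2)[OF that] by simp
  ultimately have "\<psi> 0 \<le> \<psi> 1"
    by (intro DERIV_nonneg_imp_nondecreasing[of 0 1 \<psi>]) (simp, blast)
  then show ?thesis by (simp add: \<psi>_def)
qed

lemma strongly_convex_quadratic_lower_bound:
  fixes h :: "'a::euclidean_space \<Rightarrow> real"
  assumes "strongly_convex \<mu> h"
  shows "h y \<ge> h x + grad h x \<bullet> (y - x) + \<mu> / 2 * (norm (y - x))\<^sup>2"
proof -
  define d where "d = y - x"
  have mono: "(grad h v - grad h u) \<bullet> (v - u) \<ge> \<mu> * (norm (v - u))\<^sup>2" for u v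
    using assms by (simp add: strongly_convex_def)
  have "grad h (x + t *\<^sub>R d) \<bullet> d \<ge> grad h (x + 0 *\<^sub>R d) \<bullet> d + \<mu> * (norm d)\<^sup>2 * t" if "0 \<le> t" for t
  proof (cases "t = 0")
    case False
    \<comment> \<open>Gradient monotonicity between \<open>x\<close> and
      \<open>x + t *\<^sub>R d\<close> concerns the displacement \<open>t *\<^sub>R d\<close>; one
      factor \<open>t\<close> is cancelled to reach the bound on the slope.\<close>
    then have "t * (\<mu> * (norm d)\<^sup>2 * t) \<le> t * ((grad h (x + t *\<^sub>R d) - grad h x) \<bullet> d)"
      using mono[where u = x and v = "x + t *\<^sub>R d"]
      by (simp add: power_mult_distrib power2_eq_square mult_ac)
    then have "\<mu> * (norm d)\<^sup>2 * t \<le> (grad h (x + t *\<^sub>R d) - grad h x) \<bullet> d"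
      using False that by simp
    then show ?thesis by (simp add: inner_diff_left)
  qed simp
  then have "h (x + 1 *\<^sub>R d) \<ge> h (x + 0 *\<^sub>R d) + grad h (x + 0 *\<^sub>R d) \<bullet> d + \<mu> * (norm d)\<^sup>2 / 2"
    using assms
    by (intro quadratic_minorant[where \<phi> = "\<lambda>t. h (x + t *\<^sub>R d)" and \<phi>' = "\<lambda>t. grad h (x + t *\<^sub>R d) \<bullet> d"]
        DERIV_along_line) (auto simp: strongly_convex_def)
  then show ?thesis by (simp add: d_def)
qed

text \<open>Cauchy-Schwarz turns the Lipschitz bound on the gradient into linear growth of the slope
  along the segment; the minorant for \<open>- h\<close> integrates it.\<close>

lemma L_smooth_quadratic_upper_bound:
  fixes h :: "'a::euclidean_space \<Rightarrow> real"
  assumes "L_smooth L h"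
  shows "h y \<le> h x + grad h x \<bullet> (y - x) + L / 2 * (norm (y - x))\<^sup>2"
proof -
  define d where "d = y - x"
  have "- (grad h (x + t *\<^sub>R d) \<bullet> d) \<ge> - (grad h (x + 0 *\<^sub>R d) \<bullet> d) + - (L * (norm d)\<^sup>2) * t"
    if "0 \<le> t" for t
  proof -
    have "(grad h (x + t *\<^sub>R d) - grad h x) \<bullet> d \<le> norm (grad h (x + t *\<^sub>R d) - grad h x) * norm d"
      by (rule norm_cauchy_schwarz)
    also have "\<dots> \<le> (L * norm (x + t *\<^sub>R d - x)) * norm d"
      using assms unfolding L_smooth_def by (intro mult_right_mono norm_ge_zero) blast
    finally show ?thesis using that by (simp add: inner_diff_left power2_eq_square mult_ac)
  qed
  then have "- h (x + 1 *\<^sub>R d) \<ge> - h (x + 0 *\<^sub>R d) + - (grad h (x + 0 *\<^sub>R d) \<bullet> d) + - (L * (norm d)\<^sup>2) / 2"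
    using assms
    by (intro quadratic_minorant[where \<phi> = "\<lambda>t. - h (x + t *\<^sub>R d)" and \<phi>' = "\<lambda>t. - (grad h (x + t *\<^sub>R d) \<bullet> d)"]
        DERIV_minus DERIV_along_line) (auto simp: L_smooth_def)
  then show ?thesis by (simp add: d_def)
qed

section \<open>Sublevel sets\<close>

lemma lsc_fun_open_superlevel:
  fixes g :: "'a::topological_space \<Rightarrow> ereal"
  assumes "lsc_fun g"
  shows "open {x. c < g x}"
proof (subst open_subopen, safe)
  fix x assume x: "c < g x"
  have "g x \<le> Liminf (at x) g" using assms by (simp add: lsc_fun_def)
  then have "eventually (\<lambda>z. c < g z) (at x)" using x by (simp add: le_Liminf_iff)
  \<comment> \<open>The filter \<open>at x\<close> omits \<open>x\<close>, but \<open>x\<close>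
    satisfies the strict inequality by assumption.\<close>
  then have "eventually (\<lambda>z. c < g z) (nhds x)"
    using x by (simp add: eventually_nhds_conv_at)
  then show "\<exists>T. open T \<and> x \<in> T \<and> T \<subseteq> {x. c < g x}"
    by (auto simp: eventually_nhds)
qed

lemma lsc_fun_add_continuous_closed_sublevel:
  fixes f :: "'a::topological_space \<Rightarrow> real"
  assumes "lsc_fun g" and "continuous_on UNIV f"
  shows "closed {x. ereal (f x) + g x \<le> ereal r}"
proof -
  \<comment> \<open>A real \<open>a\<close> strictly between \<open>r - f x\<close> and
    \<open>g x\<close> decouples \<open>f\<close> from \<open>g\<close>, so the complement of the
    sublevel set is a union of open sets.\<close>
  have "{x. ereal r < ereal (f x) + g x} = (\<Union>a. {x. ereal a < g x} \<inter> {x. r - a < f x})"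
  proof (safe, goal_cases)
    case (1 x)
    have "ereal (r - f x) < g x" using 1 by (cases "g x") auto
    then obtain a where "ereal (r - f x) < ereal a" "ereal a < g x"
      using ereal_dense2 by blast
    then show ?case by (intro UN_I[of a]) auto
  next
    case (2 x a)
    then show ?case by (cases "g x") auto
  qed
  moreover have "open (\<Union>a. {x. ereal a < g x} \<inter> {x. r - a < f x})"
    using assms by (intro open_UN ballI open_Int lsc_fun_open_superlevel open_Collect_less continuous_on_const) auto
  ultimately have "open {x. ereal r < ereal (f x) + g x}" by simp
  moreover have "{x. ereal (f x) + g x \<le> ereal r} = - {x. ereal r < ereal (f x) + g x}"
    by (auto simp: not_less)
  ultimately show ?thesis by (simp add: closed_def)
qed

lemma lsc_fun_bounded_below_on_compact:
  fixes g :: "'a::topological_space \<Rightarrow> ereal"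
  assumes "lsc_fun g" and "\<And>x. g x \<noteq> -\<infinity>" and "compact S"
  obtains b where "\<And>x. x \<in> S \<Longrightarrow> ereal b \<le> g x"
proof -
  have cover: "S \<subseteq> (\<Union>n::nat. {x. ereal (- real n) < g x})"
  proof
    fix x
    obtain n where "ereal (- real n) < g x"
    proof (cases "g x")
      case (real r)
      obtain n where "- r < real n" using reals_Archimedean2 by blast
      then show ?thesis using that[of n] real by simp
    qed (use assms(2) that in auto)
    then show "x \<in> (\<Union>n::nat. {x. ereal (- real n) < g x})" by blast
  qed
  obtain C :: "nat set" where C: "finite C" "S \<subseteq> (\<Union>n\<in>C. {x. ereal (- real n) < g x})"
    using compactE_image[OF assms(3) _ cover] lsc_fun_open_superlevel[OF assms(1)] by metis
  \<comment> \<open>The sum of the finite set \<open>C\<close> dominates each of its members and so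
    gives one uniform bound.\<close>
  have "ereal (- real (\<Sum>C)) \<le> g x" if x: "x \<in> S" for x
  proof -
    obtain n where n: "n \<in> C" "ereal (- real n) < g x" using C(2) x by blast
    have "n \<le> \<Sum>C" using member_le_sum[OF n(1), of "\<lambda>n. n"] C(1) by simp
    then have "ereal (- real (\<Sum>C)) \<le> ereal (- real n)" unfolding ereal_less_eq by linarith
    then show ?thesis using n(2) by order
  qed
  then show ?thesis using that by blast
qed

text \<open>Convexity propagates a lower bound of \<open>g\<close> on a unit ball to an affine minorant in the distance
  to its centre, which is dominated by the quadratic growth of \<open>f\<close>.\<close>

lemma strongly_convex_add_bounded_sublevel:
  fixes f :: "'a::euclidean_space \<Rightarrow> real"
  assumes sc: "strongly_convex \<mu> f" and "\<mu> > 0"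
    and proper: "proper_fun g" and convex: "convex_fun g" and lsc: "lsc_fun g"
  shows "bounded {x. ereal (f x) + g x \<le> ereal c}"
proof -
  have ninf: "g x \<noteq> -\<infinity>" for x using proper by (simp add: proper_fun_def)
  obtain p where "g p \<noteq> \<infinity>" using proper by (auto simp: proper_fun_def)
  then obtain G where G: "g p = ereal G" using ninf by (cases "g p") auto
  obtain b where b: "\<And>x. x \<in> cball p 1 \<Longrightarrow> ereal b \<le> g x"
    using lsc_fun_bounded_below_on_compact[OF lsc ninf compact_cball] by blast
  \<comment> \<open>For \<open>r > 1\<close> the growth estimate has the form mu/2 * r^2 <= A * r +
    B <= (|A| + |B|) * r; dividing by \<open>r\<close> leaves \<open>r \<le> K\<close>.\<close>
  define K where "K = 2 * (\<bar>G + norm (grad f p) - b\<bar> + \<bar>c - f p - G\<bar>) / \<mu>"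
  have "norm (x - p) \<le> max 1 K" if x: "ereal (f x) + g x \<le> ereal c" for x
  proof (cases "norm (x - p) \<le> 1")
    case False
    define r where "r = norm (x - p)"
    have r: "r > 1" using False by (simp add: r_def)
    obtain X where X: "g x = ereal X" using x ninf by (cases "g x") auto
    \<comment> \<open>This is the point of the segment from \<open>p\<close> to \<open>x\<close> at
      distance 1 from \<open>p\<close>, where the lower bound \<open>b\<close> is available.\<close>
    define u where "u = (1 - 1 / r) *\<^sub>R p + (1 / r) *\<^sub>R x"
    have "u - p = (1 / r) *\<^sub>R (x - p)" by (simp add: u_def algebra_simps)
    then have "norm (u - p) = 1 / r * r" using r by (simp add: r_def)
    then have "norm (u - p) = 1" using r by simp
    then have "u \<in> cball p 1" by (simp add: dist_norm norm_minus_commute)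
    then have "ereal b \<le> g u" by (rule b)
    also have "g u \<le> ereal (1 - 1 / r) * g p + ereal (1 / r) * g x"
      using convex r unfolding convex_fun_def u_def by simp
    finally have "b \<le> (1 - 1 / r) * G + (1 / r) * X" using G X by simp
    then have "r * b \<le> r * ((1 - 1 / r) * G + (1 / r) * X)"
      using r by (intro mult_left_mono) auto
    also have "\<dots> = (r - 1) * G + X" using r by (simp add: field_simps)
    finally have gX: "X \<ge> r * b - (r - 1) * G" by simp
    have "- (grad f p \<bullet> (x - p)) \<le> norm (grad f p) * r"
      using norm_cauchy_schwarz[of "- grad f p" "x - p"] by (simp add: r_def)
    then have "f x \<ge> f p - norm (grad f p) * r + \<mu> / 2 * r\<^sup>2"
      using strongly_convex_quadratic_lower_bound[OF sc, of p x] by (simp add: r_def)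
    then have "\<mu> / 2 * r\<^sup>2 \<le> (G + norm (grad f p) - b) * r + (c - f p - G)"
      using gX x X by (simp add: algebra_simps)
    also have "\<dots> \<le> \<bar>G + norm (grad f p) - b\<bar> * r + \<bar>c - f p - G\<bar> * r"
      using r mult_right_mono[of 1 r "\<bar>c - f p - G\<bar>"]
      by (intro add_mono mult_right_mono) (auto simp: mult.commute intro: order_trans[OF abs_ge_self])
    finally have "r * (\<mu> / 2 * r) \<le> r * (\<bar>G + norm (grad f p) - b\<bar> + \<bar>c - f p - G\<bar>)"
      by (simp add: algebra_simps power2_eq_square)
    then have "\<mu> / 2 * r \<le> \<bar>G + norm (grad f p) - b\<bar> + \<bar>c - f p - G\<bar>"
      using r by simp
    then have "r \<le> K" using \<open>\<mu> > 0\<close> by (simp add: K_def field_simps)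
    then show ?thesis by (simp add: r_def)
  qed simp
  then have "{x. ereal (f x) + g x \<le> ereal c} \<subseteq> cball p (max 1 K)"
    by (auto simp: dist_norm norm_minus_commute)
  then show ?thesis using bounded_cball bounded_subset by blast
qed

section \<open>The proximal step\<close>

lemma prox_model_term:
  assumes "g i x = ereal a" "g i z = ereal b" "\<alpha> i > 0"
  shows "(ereal (grad (f i) x \<bullet> (z - x)) + g i z - g i x) / ereal (\<alpha> i) + ereal (1 / 2 * (norm (z - x))\<^sup>2)
    = ereal ((grad (f i) x \<bullet> (z - x) + b - a) / \<alpha> i + 1 / 2 * (norm (z - x))\<^sup>2)"
  using assms by simp

lemma prox_model_ge:
  "(ereal (grad (f i) x \<bullet> (z - x)) + g i z - g i x) / ereal (\<alpha> i) + ereal (1 / 2 * (norm (z - x))\<^sup>2)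
    \<le> prox_model f g \<alpha> x z"
  unfolding prox_model_def by (intro Max_ge) auto

lemma prox_model_attained:
  obtains i where "prox_model f g \<alpha> x z =
    (ereal (grad (f i) x \<bullet> (z - x)) + g i z - g i x) / ereal (\<alpha> i) + ereal (1 / 2 * (norm (z - x))\<^sup>2)"
proof -
  have "prox_model f g \<alpha> x z \<in> range (\<lambda>i. (ereal (grad (f i) x \<bullet> (z - x)) + g i z - g i x) / ereal (\<alpha> i)
      + ereal (1 / 2 * (norm (z - x))\<^sup>2))"
    unfolding prox_model_def by (intro Max_in) auto
  then show ?thesis using that by blast
qed

lemma is_prox_model_le: "is_prox f g \<alpha> x z \<Longrightarrow> prox_model f g \<alpha> x z \<le> prox_model f g \<alpha> x u"
  by (auto simp: is_prox_def is_arg_min_def not_less)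

text \<open>The step is compared with staying at \<open>x\<close>, where the model is 0. Since the
  model is a maximum, each of its terms at \<open>z\<close> is nonpositive, which rules out an
  infinite \<open>g i z\<close>; multiplying by \<open>\<alpha> i\<close> gives the
  estimate.\<close>

lemma is_prox_finite_descent:
  assumes prox: "is_prox f g \<alpha> x z" and \<alpha>: "\<And>j. \<alpha> j > 0"
    and ninf: "g i z \<noteq> -\<infinity>"
    and x: "\<And>j. g j x = ereal (a j)"
  obtains b where "g i z = ereal b"
    "grad (f i) x \<bullet> (z - x) + b - a i + \<alpha> i / 2 * (norm (z - x))\<^sup>2 \<le> 0"
proof -
  obtain j where "prox_model f g \<alpha> x x =
    (ereal (grad (f j) x \<bullet> (x - x)) + g j x - g j x) / ereal (\<alpha> j) + ereal (1 / 2 * (norm (x - x))\<^sup>2)"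
    by (rule prox_model_attained)
  then have "prox_model f g \<alpha> x x = 0"
    using prox_model_term[where i = j and f = f and g = g and \<alpha> = \<alpha>, OF x x \<alpha>] by (simp add: zero_ereal_def)
  then have *: "(ereal (grad (f i) x \<bullet> (z - x)) + g i z - g i x) / ereal (\<alpha> i) + ereal (1 / 2 * (norm (z - x))\<^sup>2) \<le> 0"
    using prox_model_ge[of f i x z g \<alpha>] is_prox_model_le[OF prox, of x] by order
  have "g i z \<noteq> \<infinity>" using * \<alpha>[of i] x[of i] by auto
  then obtain b where b: "g i z = ereal b" using ninf by (cases "g i z") auto
  have "(grad (f i) x \<bullet> (z - x) + b - a i) / \<alpha> i + 1 / 2 * (norm (z - x))\<^sup>2 \<le> 0"
    using * unfolding prox_model_term[where i = i and f = f and g = g and \<alpha> = \<alpha>, OF x b \<alpha>] by (simp add: zero_ereal_def)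
  then have "\<alpha> i * ((grad (f i) x \<bullet> (z - x) + b - a i) / \<alpha> i + 1 / 2 * (norm (z - x))\<^sup>2) \<le> \<alpha> i * 0"
    using \<alpha>[of i] by (intro mult_left_mono) auto
  then have "grad (f i) x \<bullet> (z - x) + b - a i + \<alpha> i / 2 * (norm (z - x))\<^sup>2 \<le> 0"
    using \<alpha>[of i] by (simp add: distrib_left)
  then show ?thesis by (rule that[OF b])
qed

lemma is_prox_variational:
  fixes f :: "'m::finite \<Rightarrow> 'a::real_inner \<Rightarrow> real"
  assumes prox: "is_prox f g \<alpha> x z" and \<alpha>: "\<And>i. \<alpha> i > 0"
    and convex: "\<And>i. convex_fun (g i)" and ninf: "\<And>i u. g i u \<noteq> -\<infinity>"
    and x: "\<And>i. g i x = ereal (a i)" and z: "\<And>i. g i z = ereal (b i)" and y: "\<And>i. g i y = ereal (c i)"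
  obtains i where "(grad (f i) x \<bullet> (z - y) + b i - c i) / \<alpha> i \<le> (z - x) \<bullet> (y - z)"
proof -
  \<comment> \<open>First-order coefficient along the segment: from \<open>z\<close> to
    \<open>(1 - t) *\<^sub>R z + t *\<^sub>R y\<close> the \<open>i\<close>-th model term grows by
    at most \<open>t * (e i + t / 2 * D)\<close>.\<close>
  define e where "e i = (grad (f i) x \<bullet> (y - z) + c i - b i) / \<alpha> i + (z - x) \<bullet> (y - z)" for i
  define D where "D = (norm (y - z))\<^sup>2"
  have step: "\<exists>i. 0 \<le> e i + t / 2 * D" if t: "0 < t" "t < 1" for t
  proof -
    define u where "u = (1 - t) *\<^sub>R z + t *\<^sub>R y"
    have u_x: "u - x = (z - x) + t *\<^sub>R (y - z)" by (simp add: u_def algebra_simps)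
    have le: "g i u \<le> ereal ((1 - t) * b i + t * c i)" for i
    proof -
      have "g i u \<le> ereal (1 - t) * g i z + ereal t * g i y"
        using convex[of i] t unfolding convex_fun_def u_def by simp
      then show ?thesis by (simp add: y z)
    qed
    \<comment> \<open>The index attains the maximum at \<open>u\<close>. At \<open>z\<close> its
      term is only bounded above by the model, which is the direction needed.\<close>
    obtain i where i: "prox_model f g \<alpha> x u =
      (ereal (grad (f i) x \<bullet> (u - x)) + g i u - g i x) / ereal (\<alpha> i) + ereal (1 / 2 * (norm (u - x))\<^sup>2)"
      by (rule prox_model_attained)
    obtain w where w: "g i u = ereal w" using le[of i] ninf[of i u] by (cases "g i u") auto
    have "ereal ((grad (f i) x \<bullet> (z - x) + b i - a i) / \<alpha> i + 1 / 2 * (norm (z - x))\<^sup>2)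
        \<le> ereal ((grad (f i) x \<bullet> (u - x) + w - a i) / \<alpha> i + 1 / 2 * (norm (u - x))\<^sup>2)"
      using is_prox_model_le[OF prox, of u] prox_model_ge[of f i x z g \<alpha>]
      unfolding i prox_model_term[where i = i and f = f and g = g and \<alpha> = \<alpha>, OF x z \<alpha>] prox_model_term[where i = i and f = f and g = g and \<alpha> = \<alpha>, OF x w \<alpha>] by order
    then have "(grad (f i) x \<bullet> (z - x) + b i - a i) / \<alpha> i + 1 / 2 * (norm (z - x))\<^sup>2
        \<le> (grad (f i) x \<bullet> (u - x) + w - a i) / \<alpha> i + 1 / 2 * (norm (u - x))\<^sup>2" by simp
    also have "\<dots> \<le> (grad (f i) x \<bullet> (u - x) + ((1 - t) * b i + t * c i) - a i) / \<alpha> i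
        + 1 / 2 * (norm (u - x))\<^sup>2"
      using le[of i] w \<alpha>[of i] by (intro add_right_mono divide_right_mono) auto
    also have "(norm (u - x))\<^sup>2 = (norm (z - x))\<^sup>2 + 2 * t * ((z - x) \<bullet> (y - z)) + t\<^sup>2 * D"
      unfolding u_x D_def power2_norm_eq_inner
      by (simp add: inner_add_left inner_add_right inner_commute power2_eq_square)
    also have "(grad (f i) x \<bullet> (u - x) + ((1 - t) * b i + t * c i) - a i) / \<alpha> i
      = (grad (f i) x \<bullet> (z - x) + b i - a i) / \<alpha> i + t * ((grad (f i) x \<bullet> (y - z) + c i - b i) / \<alpha> i)"
      unfolding u_x inner_add_right inner_scaleR_right using \<alpha>[of i] by (simp add: field_simps)
    finally have "0 \<le> t * (e i + t / 2 * D)"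
      by (simp add: e_def algebra_simps power2_eq_square)
    then show ?thesis using t by (auto simp: zero_le_mult_iff)
  qed
  \<comment> \<open>The index given by \<open>step\<close> depends on \<open>t\<close>. If every
    \<open>e i\<close> were negative, finiteness of the index type would yield one small
    \<open>t\<close> at which all the bounds are negative.\<close>
  have "\<exists>i. 0 \<le> e i"
  proof (rule ccontr)
    assume "\<not> (\<exists>i. 0 \<le> e i)"
    then have neg: "e i < 0" for i by (simp add: not_le)
    have "\<forall>\<^sub>F t in at_right 0. e i + t / 2 * D < 0" for i
    proof -
      have "((\<lambda>t. e i + t / 2 * D) \<longlongrightarrow> e i + 0 / 2 * D) (at_right 0)"
        by (intro tendsto_intros) auto
      then show ?thesis using neg[of i] by (intro order_tendstoD(2)) auto
    qed
    then have "\<forall>\<^sub>F t in at_right 0. \<forall>i. e i + t / 2 * D < 0"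
      by (rule eventually_all_finite)
    moreover have "\<forall>\<^sub>F t::real in at_right 0. 0 < t \<and> t < 1"
      by (rule eventually_at_rightI[of 0 1]) auto
    ultimately have "\<forall>\<^sub>F t in at_right 0. (\<forall>i. e i + t / 2 * D < 0) \<and> 0 < t \<and> t < 1"
      by (rule eventually_conj)
    then obtain t where "\<forall>i. e i + t / 2 * D < 0" "0 < t" "t < 1"
      using eventually_happens'[OF trivial_limit_at_right_real] by fast
    then show False using step[of t] by (meson not_le)
  qed
  then obtain i where "0 \<le> e i" ..
  moreover have "(grad (f i) x \<bullet> (z - y) + b i - c i) / \<alpha> i = - ((grad (f i) x \<bullet> (y - z) + c i - b i) / \<alpha> i)"
    by (simp add: inner_diff_right diff_divide_distrib add_divide_distrib)
  ultimately show ?thesis using that[of i] by (simp add: e_def)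
qed

lemma is_prox_contraction:
  fixes f :: "'m::finite \<Rightarrow> 'a::euclidean_space \<Rightarrow> real"
  assumes prox: "is_prox f g \<alpha> x z" and \<alpha>: "\<And>i. \<alpha> i > 0"
    and ok: "\<And>i. descent_ok f \<alpha> x z i"
    and sc: "\<And>i. strongly_convex (\<mu> i) (f i)"
    and convex: "\<And>i. convex_fun (g i)" and ninf: "\<And>i u. g i u \<noteq> -\<infinity>"
    and x: "\<And>i. g i x = ereal (a i)" and z: "\<And>i. g i z = ereal (b i)" and y: "\<And>i. g i y = ereal (c i)"
    and le: "\<And>i. f i y + c i \<le> f i z + b i"
  obtains i where "(norm (z - y))\<^sup>2 \<le> (1 - \<mu> i / \<alpha> i) * (norm (x - y))\<^sup>2"
proof -
  obtain i where i: "(grad (f i) x \<bullet> (z - y) + b i - c i) / \<alpha> i \<le> (z - x) \<bullet> (y - z)"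
    using is_prox_variational[OF prox \<alpha> convex ninf x z y] by blast
  \<comment> \<open>The acceptance test bounds \<open>f i z\<close> from above, strong convexity at
    \<open>x\<close> bounds \<open>f i y\<close> from below, and \<open>le\<close> links the two;
    \<open>f i x\<close> cancels.\<close>
  have "0 \<le> grad (f i) x \<bullet> (z - y) + b i - c i + \<alpha> i / 2 * (norm (z - x))\<^sup>2 - \<mu> i / 2 * (norm (x - y))\<^sup>2"
    using ok[of i] le[of i] strongly_convex_quadratic_lower_bound[OF sc, of i x y]
    by (simp add: descent_ok_def inner_diff_right norm_minus_commute)
  then have "0 \<le> (grad (f i) x \<bullet> (z - y) + b i - c i + \<alpha> i / 2 * (norm (z - x))\<^sup>2
      - \<mu> i / 2 * (norm (x - y))\<^sup>2) / \<alpha> i"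
    using \<alpha>[of i] by simp
  also have "\<dots> = (grad (f i) x \<bullet> (z - y) + b i - c i) / \<alpha> i + 1 / 2 * (norm (z - x))\<^sup>2
      - \<mu> i / \<alpha> i / 2 * (norm (x - y))\<^sup>2"
    using \<alpha>[of i] by (simp add: field_simps)
  also have "\<dots> \<le> (z - x) \<bullet> (y - z) + 1 / 2 * (norm (z - x))\<^sup>2 - \<mu> i / \<alpha> i / 2 * (norm (x - y))\<^sup>2"
    using i by simp
  \<comment> \<open>Three-point identity: the distance of the step disappears and only distances to
    \<open>y\<close> remain.\<close>
  also have "(z - x) \<bullet> (y - z) + 1 / 2 * (norm (z - x))\<^sup>2 = 1 / 2 * (norm (x - y))\<^sup>2 - 1 / 2 * (norm (z - y))\<^sup>2"
    unfolding power2_norm_eq_inner by (simp add: inner_diff_left inner_diff_right inner_commute field_simps)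
  finally have "(norm (z - y))\<^sup>2 \<le> (1 - \<mu> i / \<alpha> i) * (norm (x - y))\<^sup>2" by (simp add: algebra_simps)
  then show ?thesis by (rule that)
qed

section \<open>The step-size parameters\<close>

text \<open>Both Barzilai-Borwein quotients are at most the Lipschitz constant. Clipping from above
  only lowers them, and clipping from below is harmless because the lower threshold is itself at
  most \<open>L i\<close>.\<close>

lemma bb_init_bounds:
  assumes "L_smooth (L i) (f i)" and "0 < \<alpha>\<^sub>m\<^sub>i\<^sub>n" and "\<alpha>\<^sub>m\<^sub>i\<^sub>n \<le> L i"
  shows "0 < bb_init f \<alpha>\<^sub>m\<^sub>i\<^sub>n \<alpha>\<^sub>m\<^sub>a\<^sub>x p x i" and "bb_init f \<alpha>\<^sub>m\<^sub>i\<^sub>n \<alpha>\<^sub>m\<^sub>a\<^sub>x p x i \<le> L i"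
proof -
  define s where "s = x - p"
  define y where "y = grad (f i) x - grad (f i) p"
  have y: "norm y \<le> L i * norm s"
    using assms(1) by (simp add: L_smooth_def y_def s_def)
  have "s \<bullet> y \<le> norm s * norm y" by (rule norm_cauchy_schwarz)
  also have "\<dots> \<le> norm s * (L i * norm s)" by (intro mult_left_mono y) simp
  also have "\<dots> = L i * (s \<bullet> s)" by (simp add: power2_norm_eq_inner[symmetric] power2_eq_square)
  finally have "s \<bullet> y / (s \<bullet> s) \<le> L i" if "s \<noteq> 0"
    using that by (simp add: pos_divide_le_eq)
  moreover have "norm y / norm s \<le> L i" if "s \<noteq> 0"
    using that y by (simp add: pos_divide_le_eq)
  \<comment> \<open>Both quotient branches have a nonzero inner product, so neither divides by
    zero.\<close>
  moreover have "s \<noteq> 0" if "s \<bullet> y \<noteq> 0" using that by auto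
  ultimately show "0 < bb_init f \<alpha>\<^sub>m\<^sub>i\<^sub>n \<alpha>\<^sub>m\<^sub>a\<^sub>x p x i" and "bb_init f \<alpha>\<^sub>m\<^sub>i\<^sub>n \<alpha>\<^sub>m\<^sub>a\<^sub>x p x i \<le> L i"
    using assms(2,3) unfolding bb_init_def Let_def s_def[symmetric] y_def[symmetric]
    by (auto simp: min_le_iff_disj)
qed

text \<open>A parameter is enlarged only after its test failed, hence only while it is below \<open>L\<^sub>i\<close>.\<close>

lemma backtrack_final_parameters:
  fixes f :: "'m::finite \<Rightarrow> 'a::euclidean_space \<Rightarrow> real"
  assumes "backtrack f g \<tau> x \<alpha> z"
    and "\<And>i. L_smooth (L i) (f i)" and "\<tau> > 1"
    and "\<And>i. 0 < \<alpha> i" and "\<And>i. \<alpha> i \<le> \<tau> * L i"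
  shows "\<exists>\<beta>. is_prox f g \<beta> x z \<and> (\<forall>i. descent_ok f \<beta> x z i \<and> 0 < \<beta> i \<and> \<beta> i \<le> \<tau> * L i)"
  using assms
proof (induction rule: backtrack.induct)
  case (accept \<alpha> z)
  then show ?case by blast
next
  case (enlarge \<alpha> w z)
  have "\<alpha> i \<le> L i" if "\<not> descent_ok f \<alpha> x w i" for i
  proof -
    \<comment> \<open>The failed test contradicts the quadratic upper bound unless
      \<open>\<alpha> i < L i\<close>; one multiplication by \<open>\<tau>\<close> then keeps the
      invariant.\<close>
    have "\<alpha> i / 2 * (norm (w - x))\<^sup>2 < L i / 2 * (norm (w - x))\<^sup>2"
      using that L_smooth_quadratic_upper_bound[OF enlarge.prems(1)[of i], of w x]
      by (simp add: descent_ok_def)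
    then show ?thesis by (simp add: mult_less_cancel_right)
  qed
  then show ?case using enlarge.prems by (intro enlarge.IH) auto
qed

section \<open>Convergence\<close>

lemma linear_contraction_tendsto:
  fixes x :: "nat \<Rightarrow> 'a::real_normed_vector"
  assumes "\<rho> < 1" and "\<And>k. norm (x (Suc k) - y) \<le> \<rho> * norm (x k - y)"
  shows "x \<longlonglongrightarrow> y"
proof -
  \<comment> \<open>The sign of \<open>\<rho>\<close> is open, while the induction multiplies
    inequalities by the factor; hence the clipping at 0.\<close>
  define r where "r = max 0 \<rho>"
  have r: "0 \<le> r" "r < 1" using assms(1) by (auto simp: r_def)
  have bound: "norm (x k - y) \<le> r ^ k * norm (x 0 - y)" for k
  proof (induction k)
    case (Suc k)
    have "norm (x (Suc k) - y) \<le> \<rho> * norm (x k - y)" by (rule assms(2))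
    also have "\<dots> \<le> r * norm (x k - y)" by (intro mult_right_mono) (auto simp: r_def)
    also have "\<dots> \<le> r * (r ^ k * norm (x 0 - y))" by (intro mult_left_mono Suc r)
    finally show ?case by simp
  qed simp
  have "(\<lambda>k. r ^ k * norm (x 0 - y)) \<longlonglongrightarrow> 0 * norm (x 0 - y)"
    using r by (intro tendsto_mult LIMSEQ_realpow_zero tendsto_const)
  then have "(\<lambda>k. x k - y) \<longlonglongrightarrow> 0"
    using bound by (intro Lim_null_comparison[of "\<lambda>k. x k - y"] always_eventually) auto
  then show ?thesis by (simp add: LIM_zero_iff)
qed

lemma mem_domF_objective:
  assumes "\<And>i. g i y \<noteq> -\<infinity>"
  shows "y \<in> domF (objective f g) \<longleftrightarrow> (\<forall>i. g i y = ereal (real_of_ereal (g i y)))"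
  unfolding domF_def objective_def mem_Collect_eq
proof (intro iff_allI)
  show "(\<bar>ereal (f i y) + g i y\<bar> \<noteq> \<infinity>) = (g i y = ereal (real_of_ereal (g i y)))" for i
    using assms[of i] by (cases "g i y") auto
qed

theorem theorem4p6:
  fixes f :: "'m::finite \<Rightarrow> real ^ 'n \<Rightarrow> real"
    and g :: "'m \<Rightarrow> real ^ 'n \<Rightarrow> ereal"
    and L \<mu> :: "'m \<Rightarrow> real"
    and \<tau> \<alpha>\<^sub>m\<^sub>i\<^sub>n \<alpha>\<^sub>m\<^sub>a\<^sub>x :: real
    and xm1 :: "real ^ 'n" and x :: "nat \<Rightarrow> real ^ 'n"
  assumes f_C1: "\<And>i. continuously_differentiable (f i)"
    and f_smooth: "\<And>i. L_smooth (L i) (f i)"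
    and f_strongly_convex: "\<And>i. \<mu> i > 0 \<and> strongly_convex (\<mu> i) (f i)"
    and g_proper: "\<And>i. proper_fun (g i)"
    and g_convex: "\<And>i. convex_fun (g i)"
    and g_lsc: "\<And>i. lsc_fun (g i)"
    and tau: "\<tau> > 1"
    and alpha: "0 < \<alpha>\<^sub>m\<^sub>i\<^sub>n" "\<alpha>\<^sub>m\<^sub>i\<^sub>n < \<alpha>\<^sub>m\<^sub>a\<^sub>x"
    and alpha_min_le: "\<alpha>\<^sub>m\<^sub>i\<^sub>n \<le> (MIN i. L i)"
    and start: "x 0 \<in> domF (objective f g)"
    and run: "abbpgmo f g \<tau> \<alpha>\<^sub>m\<^sub>i\<^sub>n \<alpha>\<^sub>m\<^sub>a\<^sub>x xm1 x"
    and not_critical: "\<And>k. \<not> pareto_critical (objective f g) (x k)"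
  shows "\<exists>xs. x \<longlonglongrightarrow> xs \<and> pareto_solution (objective f g) xs \<and>
    (\<forall>k. norm (x (Suc k) - xs)
           \<le> sqrt (1 - (MIN i. \<mu> i / (\<tau> * L i))) * norm (x k - xs))"
proof -
  let ?F = "objective f g"
  define G where "G i u = real_of_ereal (g i u)" for i u
  define \<rho> where "\<rho> = sqrt (1 - (MIN i. \<mu> i / (\<tau> * L i)))"
  define S where "S k = {y. ?F y \<le> ?F (x k)}" for k
  have ninf: "g i u \<noteq> -\<infinity>" for i u using g_proper[of i] by (simp add: proper_fun_def)
  have dom: "u \<in> domF ?F \<longleftrightarrow> (\<forall>i. g i u = ereal (G i u))" for u
    unfolding G_def by (rule mem_domF_objective) (rule ninf)
  have sc: "strongly_convex (\<mu> i) (f i)" and mu: "\<mu> i > 0" for i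
    using f_strongly_convex by auto
  have "(MIN i. L i) \<le> L i" for i by (intro Min_le) auto
  then have min_L: "\<alpha>\<^sub>m\<^sub>i\<^sub>n \<le> L i" for i using alpha_min_le order_trans by blast
  then have L: "L i > 0" for i using alpha(1) less_le_trans by blast
  then have L_tau: "L i \<le> \<tau> * L i" for i using tau mult_right_mono[of 1 \<tau> "L i"] by (simp add: less_imp_le)
  \<comment> \<open>The relation \<open>backtrack\<close> hides the accepted parameters; they are
    recovered here, one vector for each \<open>k\<close>.\<close>
  have "\<exists>\<beta>. is_prox f g \<beta> (x k) (x (Suc k)) \<and>
      (\<forall>i. descent_ok f \<beta> (x k) (x (Suc k)) i \<and> 0 < \<beta> i \<and> \<beta> i \<le> \<tau> * L i)" for k
  proof (rule backtrack_final_parameters[OF _ f_smooth tau])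
    let ?p = "case k of 0 \<Rightarrow> xm1 | Suc j \<Rightarrow> x j"
    show "backtrack f g \<tau> (x k) (bb_init f \<alpha>\<^sub>m\<^sub>i\<^sub>n \<alpha>\<^sub>m\<^sub>a\<^sub>x ?p (x k)) (x (Suc k))"
      using run unfolding abbpgmo_def Let_def by blast
    show "0 < bb_init f \<alpha>\<^sub>m\<^sub>i\<^sub>n \<alpha>\<^sub>m\<^sub>a\<^sub>x ?p (x k) i" for i
      by (rule bb_init_bounds(1)[where f = f and L = L and i = i, OF f_smooth alpha(1) min_L])
    show "bb_init f \<alpha>\<^sub>m\<^sub>i\<^sub>n \<alpha>\<^sub>m\<^sub>a\<^sub>x ?p (x k) i \<le> \<tau> * L i" for i
      using bb_init_bounds(2)[where f = f and L = L and i = i, OF f_smooth alpha(1) min_L] L_tau by (rule order_trans)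
  qed
  then obtain \<beta> where prox: "\<And>k. is_prox f g (\<beta> k) (x k) (x (Suc k))"
    and ok: "\<And>k i. descent_ok f (\<beta> k) (x k) (x (Suc k)) i"
    and beta: "\<And>k i. 0 < \<beta> k i" "\<And>k i. \<beta> k i \<le> \<tau> * L i" by metis

  \<comment> \<open>Adding the model estimate to the acceptance test cancels the quadratic terms.
    Domain membership is carried along because the model estimate needs finite values at
    \<open>x k\<close>.\<close>
  have descent: "x (Suc k) \<in> domF ?F \<and> ?F (x (Suc k)) \<le> ?F (x k)" if "x k \<in> domF ?F" for k
  proof -
    have G: "g i (x k) = ereal (G i (x k))" for i using that dom by blast
    have *: "g i (x (Suc k)) = ereal (G i (x (Suc k))) \<and>
        f i (x (Suc k)) + G i (x (Suc k)) \<le> f i (x k) + G i (x k)" for i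
    proof -
      obtain b where b: "g i (x (Suc k)) = ereal b"
        "grad (f i) (x k) \<bullet> (x (Suc k) - x k) + b - G i (x k) + \<beta> k i / 2 * (norm (x (Suc k) - x k))\<^sup>2 \<le> 0"
        using is_prox_finite_descent[OF prox beta(1) ninf G] by blast
      then show ?thesis using ok[of k i] by (simp add: descent_ok_def G_def)
    qed
    have "?F (x (Suc k)) i \<le> ?F (x k) i" for i
      using *[of i] G[of i] by (simp add: objective_def)
    then show ?thesis using * dom by (auto simp: le_fun_def)
  qed
  have x_dom: "x k \<in> domF ?F" for k by (induction k) (use start descent in auto)
  have F_mono: "?F (x n) \<le> ?F (x m)" if "m \<le> n" for m n
    by (rule lift_Suc_antimono_le[OF _ that]) (use descent x_dom in blast)

  have S_dom: "y \<in> domF ?F" if "y \<in> S k" for y k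
  proof -
    have "g i y = ereal (G i y)" for i
    proof -
      have "ereal (f i y) + g i y \<le> ereal (f i (x k)) + g i (x k)"
        using that by (simp add: S_def le_fun_def objective_def)
      moreover have "g i (x k) = ereal (G i (x k))" using x_dom dom by blast
      ultimately have "g i y \<noteq> \<infinity>" by auto
      then show ?thesis using ninf[of i y] unfolding G_def by (cases "g i y") auto
    qed
    then show ?thesis using dom by blast
  qed
  have attract: "norm (x (Suc k) - y) \<le> \<rho> * norm (x k - y)" if "\<And>k. y \<in> S k" for y k
  proof -
    have G: "g i y = ereal (G i y)" "g i (x k) = ereal (G i (x k))"
      "g i (x (Suc k)) = ereal (G i (x (Suc k)))" for i
      using S_dom[OF that] x_dom dom by blast+
    have "ereal (f i y) + g i y \<le> ereal (f i (x (Suc k))) + g i (x (Suc k))" for i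
      \<comment> \<open>The contraction compares \<open>y\<close> with the new iterate, so
        membership is used at \<open>Suc k\<close>.\<close>
      using that[of "Suc k"] by (simp add: S_def le_fun_def objective_def)
    then have le: "f i y + G i y \<le> f i (x (Suc k)) + G i (x (Suc k))" for i
      unfolding G by simp
    obtain i where i: "(norm (x (Suc k) - y))\<^sup>2 \<le> (1 - \<mu> i / \<beta> k i) * (norm (x k - y))\<^sup>2"
      using is_prox_contraction[OF prox beta(1) ok sc g_convex ninf G(2,3,1) le] by blast
    \<comment> \<open>The index \<open>i\<close> may change with \<open>k\<close>; the minimum
      yields one rate for all steps.\<close>
    have "(MIN i. \<mu> i / (\<tau> * L i)) \<le> \<mu> i / (\<tau> * L i)" by (intro Min_le) auto
    also have "\<dots> \<le> \<mu> i / \<beta> k i" using beta[where k = k and i = i] mu[of i] by (intro divide_left_mono) auto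
    finally have "(1 - \<mu> i / \<beta> k i) * (norm (x k - y))\<^sup>2 \<le> (1 - (MIN i. \<mu> i / (\<tau> * L i))) * (norm (x k - y))\<^sup>2"
      by (intro mult_right_mono diff_left_mono zero_le_power2)
    then have "(norm (x (Suc k) - y))\<^sup>2 \<le> (1 - (MIN i. \<mu> i / (\<tau> * L i))) * (norm (x k - y))\<^sup>2"
      using i by linarith
    \<comment> \<open>On the reals \<open>sqrt\<close> is extended as an odd function, so it is
      monotone and multiplicative whatever the sign of the radicand.\<close>
    from real_sqrt_le_mono[OF this] show ?thesis by (simp add: real_sqrt_mult \<rho>_def)
  qed
  have "(MIN i. \<mu> i / (\<tau> * L i)) \<in> range (\<lambda>i. \<mu> i / (\<tau> * L i))" by (intro Min_in) auto
  then have "(MIN i. \<mu> i / (\<tau> * L i)) > 0" using mu L tau by auto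
  then have rho: "\<rho> < 1" by (simp add: \<rho>_def)
  have lim: "x \<longlonglongrightarrow> y" if "\<And>k. y \<in> S k" for y
    by (rule linear_contraction_tendsto[OF rho]) (rule attract[OF that])

  have "compact (S k)" for k
  proof -
    define r where "r i = f i (x k) + G i (x k)" for i
    have S: "S k = (\<Inter>i. {y. ereal (f i y) + g i y \<le> ereal (r i)})"
    proof -
      have "?F (x k) i = ereal (r i)" for i
        using x_dom[of k] dom by (simp add: objective_def r_def)
      then show ?thesis by (auto simp: S_def le_fun_def objective_def)
    qed
    have "compact {y. ereal (f i y) + g i y \<le> ereal (r i)}" for i
    proof (subst compact_eq_bounded_closed, intro conjI)
      show "bounded {y. ereal (f i y) + g i y \<le> ereal (r i)}"
        by (rule strongly_convex_add_bounded_sublevel[OF sc mu g_proper g_convex g_lsc])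
      have "continuous_on UNIV (f i)"
        using f_C1[of i] by (auto simp: continuously_differentiable_def
          intro!: differentiable_imp_continuous_on differentiable_at_imp_differentiable_on)
      then show "closed {y. ereal (f i y) + g i y \<le> ereal (r i)}"
        by (rule lsc_fun_add_continuous_closed_sublevel[OF g_lsc])
    qed
    then show ?thesis unfolding S by (intro compact_Inter) auto
  qed
  moreover have "S k \<noteq> {}" for k by (auto simp: S_def)
  moreover have "S n \<subseteq> S m" if "m \<le> n" for m n
    using F_mono[OF that] by (auto simp: S_def intro: order_trans)
  \<comment> \<open>The limit candidate comes from Cantor's intersection theorem, before convergence
    of the iterates is known.\<close>
  ultimately have "\<Inter>(range S) \<noteq> {}" by (rule compact_nest)
  then obtain xs where xs: "\<And>k. xs \<in> S k" by blast

  have "pareto_solution ?F xs"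
    unfolding pareto_solution_def
  proof (intro conjI notI)
    show "xs \<in> domF ?F" using S_dom xs by blast
    assume "\<exists>y. ?F y \<le> ?F xs \<and> ?F y \<noteq> ?F xs"
    then obtain y where y: "?F y \<le> ?F xs" "?F y \<noteq> ?F xs" by blast
    have "y \<in> S k" for k using y(1) xs[of k] by (auto simp: S_def intro: order_trans)
    \<comment> \<open>The iterates converge to every point common to all \<open>S k\<close>, so two
      such points coincide.\<close>
    then have "y = xs" using lim xs LIMSEQ_unique by blast
    then show False using y(2) by simp
  qed
  then show ?thesis using lim[OF xs] attract[OF xs] unfolding \<rho>_def by blast
qed

end
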